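(* Let $V$ be a finite set with $|V|=n$. No two different Sperner hypergraphs on $V$ share exactly the same set of linear equalities in $\mathrm{MEMS}_n$. That is, if $H_1=(V,E_1)$ and $H_2=(V,E_2)$ are Sperner hypergraphs on $V$, all of whose hyperedges have at least two vertices, and the sets of linear equalities of $H_1$ and $H_2$ coincide, i.e. $\ker\bigl(R(H_1)^{\mathsf T}\bigr)=\ker\bigl(R(H_2)^{\mathsf T}\bigr)$ as subspaces of $\mathbb{R}^{\Pi^\ast(V)}$, then $E_1=E_2$.
   Context: A Sperner hypergraph on a finite vertex set $V$ is a pair $H=(V,E)$ with $E\subseteq 2^V$ an antichain under inclusion (no hyperedge is contained in another). For a finite set $S$, $\Pi(S)$ is the set of all set partitions of $S$ and $\Pi^\ast(S)$ is the set of nontrivial partitions, i.e. those with at least two blocks. For a partition $\pi$ of $V$ and $e\subseteq V$, the restriction $\pi|_e\in\Pi(e)$ is obtained by intersecting each block of $\pi$ with $e$ and deleting empty intersections. The partition-reduction matrix $R(H)$ is the $0$-$1$ real matrix whose rows are indexed by $\pi\in\Pi^\ast(V)$ and whose columns are indexed by pairs $(e,\pi_e)$ with $e\in E$ and $\pi_e\in\Pi^\ast(e)$, with entries $R(H)_{\pi,(e,\pi_e)}=1$ if $\pi|_e=\pi_e$ and $0$ otherwise. $\mathrm{MEMS}_n$ (Multi-entanglement Measure Space) is the real vector space with one coordinate for each $\pi\in\Pi^\ast(V)$, identified with $\mathbb{R}^{\Pi^\ast(V)}$. The linear equalities of $H$ are the homogeneous linear relations $\sum_{\pi}c_\pi x_\pi=0$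 on $x\in\mathbb{R}^{\Pi^\ast(V)}$ whose coefficient vectors $c$ lie in the left nullspace $\ker(R(H)^{\mathsf T})$, i.e. satisfy $c^{\mathsf T}R(H)=0$. *)

theory Defs
  imports Complex_Main "HOL-Library.Disjoint_Sets" "HOL-Library.FuncSet"
begin

definition sperner_hypergraph :: "'v set \<Rightarrow> 'v set set \<Rightarrow> bool" where
  "sperner_hypergraph V E \<longleftrightarrow>
     finite V \<and> E \<subseteq> Pow V \<and> pairwise (\<lambda>e f. \<not> e \<subseteq> f) E"

(* Only used for finite S, where every partition has finitely many blocks. *)
definition nontrivial_partitions :: "'v set \<Rightarrow> 'v set set set" where
  "nontrivial_partitions S = {P. partition_on S P \<and> card P \<ge> 2}"

definition restrict_partition :: "'v set set \<Rightarrow> 'v set \<Rightarrow> 'v set set" where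
  "restrict_partition P e = (\<lambda>B. B \<inter> e) ` P - {{}}"

(* A real matrix is a function of a row and a column index together with finite index sets.
   Vectors indexed by J are extensional functions on J, so that equality of sets of
   vectors is equality as subsets of R^J. *)
definition mat_kernel :: "'i set \<Rightarrow> 'j set \<Rightarrow> ('i \<Rightarrow> 'j \<Rightarrow> real) \<Rightarrow> ('j \<Rightarrow> real) set" where
  "mat_kernel I J M = {x \<in> J \<rightarrow>\<^sub>E UNIV. \<forall>i\<in>I. (\<Sum>j\<in>J. M i j * x j) = 0}"

definition mat_transpose :: "('i \<Rightarrow> 'j \<Rightarrow> real) \<Rightarrow> 'j \<Rightarrow> 'i \<Rightarrow> real" where
  "mat_transpose M = (\<lambda>j i. M i j)"

definition R_rows :: "'v set \<Rightarrow> 'v set set set" where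
  "R_rows V = nontrivial_partitions V"

definition R_cols :: "'v set set \<Rightarrow> ('v set \<times> 'v set set) set" where
  "R_cols E = (SIGMA e:E. nontrivial_partitions e)"

(* The entry formula does not mention the hypergraph, which enters through the index sets
   R_rows V and R_cols E. *)
definition R_entry :: "'v set set \<Rightarrow> 'v set \<times> 'v set set \<Rightarrow> real" where
  "R_entry P c = (if restrict_partition P (fst c) = snd c then 1 else 0)"

(* A relation "sum of c P * x P over P = 0" on MEMS is represented by its coefficient
   vector c; these form the kernel of the transpose of R(H) for H = (V, E). *)
definition linear_equalities :: "'v set \<Rightarrow> 'v set set \<Rightarrow> ('v set set \<Rightarrow> real) set" where
  "linear_equalities V E = mat_kernel (R_cols E) (R_rows V) (mat_transpose R_entry)"

end

theory Submission
  imports Defs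
begin

text \<open>
  It suffices to show that every edge \<open>e\<close> of one hypergraph is contained in an edge of the other.
  Otherwise, give weight \<open>(-1)^m (m-1)!\<close>, the Moebius function of the partition lattice up to sign, to
  each partition of \<open>V\<close> made of \<open>m\<close> blocks partitioning \<open>e\<close> and the block \<open>V - e\<close>.
  A partition of \<open>e - {v}\<close> with \<open>m \<ge> 1\<close> blocks has \<open>m\<close> extensions to \<open>e\<close> with \<open>m\<close> blocks
  and one with \<open>m + 1\<close> blocks, so the weights cancel on the fibres of restriction to any \<open>f\<close> missing a
  vertex of \<open>e\<close>. They do not cancel for \<open>f = e\<close>, where the fibres are single points.
\<close>

definition moebius_weight :: "nat \<Rightarrow> real" where
  "moebius_weight m = (-1) ^ m * fact (m - 1)"

text \<open>The two terms are \<open>m!\<close> with opposite signs. For \<open>m = 0\<close> the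
  left-hand side would be \<open>-1\<close>, so the fibre argument has to supply a block that
  counts.\<close>

lemma moebius_weight_cancel:
  assumes "m \<ge> 1"
  shows "moebius_weight (Suc m) + real m * moebius_weight m = 0"
  using assms by (cases m) (simp_all add: moebius_weight_def algebra_simps)

section \<open>Extending a partition by one vertex\<close>

definition add_to_block :: "'v \<Rightarrow> 'v set set \<Rightarrow> 'v set \<Rightarrow> 'v set set" where
  "add_to_block v \<tau> B = insert (insert v B) (\<tau> - {B})"

lemma partition_on_add_to_block:
  assumes "partition_on (V - {v}) \<tau>" "v \<in> V" "B \<in> insert {} \<tau>"
  shows "partition_on V (add_to_block v \<tau> B)"
proof (rule partition_onI)
  have U: "\<Union>\<tau> = V - {v}" and ne: "{} \<notin> \<tau>"
    and dj: "\<And>p q. p \<in> \<tau> \<Longrightarrow> q \<in> \<tau> \<Longrightarrow> p \<noteq> q \<Longrightarrow> p \<inter> q = {}"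
    using assms(1) by (auto simp: partition_on_def disjoint_def)
  show "\<Union>(add_to_block v \<tau> B) = V"
    using U assms(2,3) unfolding add_to_block_def by blast
  show "{} \<notin> add_to_block v \<tau> B"
    using ne unfolding add_to_block_def by blast
  show "disjnt p q" if "p \<in> add_to_block v \<tau> B" "q \<in> add_to_block v \<tau> B" "p \<noteq> q" for p q
  proof -
    have "insert v B \<inter> r = {}" if "r \<in> \<tau> - {B}" for r
      using that U dj[of B r] assms(3) by blast
    then show ?thesis
      using that dj unfolding add_to_block_def disjnt_def by blast
  qed
qed

lemma partition_obtain_add_to_block:
  assumes "partition_on V \<pi>" "v \<in> V"
  obtains \<tau> B where "partition_on (V - {v}) \<tau>" "B \<in> insert {} \<tau>" "\<pi> = add_to_block v \<tau> B"
proof -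
  have U: "\<Union>\<pi> = V" and ne: "{} \<notin> \<pi>"
    and dj: "\<And>p q. p \<in> \<pi> \<Longrightarrow> q \<in> \<pi> \<Longrightarrow> p \<noteq> q \<Longrightarrow> p \<inter> q = {}"
    using assms(1) by (auto simp: partition_on_def disjoint_def)
  obtain C where C: "C \<in> \<pi>" "v \<in> C" using U assms(2) by blast
  define B where "B = C - {v}"
  \<comment> \<open>If \<open>v\<close> is alone in its block, then \<open>B\<close> is empty and
    must not become a block of \<open>\<tau>\<close>.\<close>
  define \<tau> where "\<tau> = insert B (\<pi> - {C}) - {{}}"
  have vn: "v \<notin> p" if "p \<in> \<pi> - {C}" for p using that C dj[of C p] by blast
  have Bd: "B \<inter> p = {}" if "p \<in> \<pi> - {C}" for p using that C dj[of C p] B_def by blast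
  have Bn: "B \<notin> \<pi> - {C}" using Bd[of B] ne by auto
  have "partition_on (V - {v}) \<tau>"
  proof (rule partition_onI)
    have "\<Union>\<tau> = B \<union> \<Union>(\<pi> - {C})" unfolding \<tau>_def by blast
    also have "\<dots> = V - {v}" using U C vn unfolding B_def by blast
    finally show "\<Union>\<tau> = V - {v}" .
    show "{} \<notin> \<tau>" using \<tau>_def by blast
    show "disjnt p q" if "p \<in> \<tau>" "q \<in> \<tau>" "p \<noteq> q" for p q
      using that dj Bd unfolding \<tau>_def disjnt_def by blast
  qed
  moreover have "B \<in> insert {} \<tau>" unfolding \<tau>_def by blast
  moreover have "\<pi> = add_to_block v \<tau> B"
  proof -
    have "insert v B = C" using C B_def by blast
    moreover have "\<tau> - {B} = \<pi> - {C}" using Bn ne unfolding \<tau>_def by blast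
    ultimately show ?thesis using C unfolding add_to_block_def by blast
  qed
  ultimately show ?thesis using that by blast
qed

text \<open>The only block containing \<open>v\<close> reveals \<open>B\<close>, and the blocks
  without \<open>v\<close> reveal \<open>\<tau> - {B}\<close>. This determines
  \<open>\<tau>\<close>, since \<open>B\<close> is one of its blocks exactly when it is
  nonempty.\<close>

lemma add_to_block_inject:
  assumes "partition_on W \<tau>" "partition_on W \<tau>'" "v \<notin> W"
    and "B \<in> insert {} \<tau>" "B' \<in> insert {} \<tau>'"
    and eq: "add_to_block v \<tau> B = add_to_block v \<tau>' B'"
  shows "\<tau> = \<tau>' \<and> B = B'"
proof -
  have v: "\<And>p. p \<in> \<tau> \<Longrightarrow> v \<notin> p" "\<And>p. p \<in> \<tau>' \<Longrightarrow> v \<notin> p"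
    and ne: "{} \<notin> \<tau>" "{} \<notin> \<tau>'"
    using assms(1-3) by (auto simp: partition_on_def)
  have vB: "v \<notin> B" "v \<notin> B'" using v assms(4,5) by auto
  have blocks: "{p \<in> add_to_block v \<tau> B. v \<in> p} = {insert v B}"
    "{p \<in> add_to_block v \<tau>' B'. v \<in> p} = {insert v B'}"
    using v unfolding add_to_block_def by auto
  have "insert v B = insert v B'" using blocks eq by simp
  then have B: "B = B'" using vB by (simp add: insert_ident)
  have rest: "{p \<in> add_to_block v \<tau> B. v \<notin> p} = \<tau> - {B}"
    "{p \<in> add_to_block v \<tau>' B'. v \<notin> p} = \<tau>' - {B'}"
    using v unfolding add_to_block_def by auto
  have "\<tau> - {B} = \<tau>' - {B}" using rest eq B by simp
  moreover have "B \<in> \<tau> \<longleftrightarrow> B \<noteq> {}" "B \<in> \<tau>' \<longleftrightarrow> B \<noteq> {}" using assms(4,5) ne B by auto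
  ultimately show ?thesis using B by blast
qed

text \<open>A vertex outside \<open>f\<close> is invisible after restriction, and a new block
  \<open>{v}\<close> restricts to the deleted empty set. Hence all extensions of
  \<open>\<tau>\<close> lie in the same fibre.\<close>

lemma restrict_add_to_block:
  assumes "v \<notin> f" "B \<in> insert {} \<tau>"
  shows "restrict_partition (add_to_block v \<tau> B) f = restrict_partition \<tau> f"
proof -
  have "insert v B \<inter> f = B \<inter> f" using assms(1) by blast
  then show ?thesis
    using assms(2) unfolding restrict_partition_def add_to_block_def by auto
qed

section \<open>Cancellation on the fibres of restriction\<close>

lemma finite_partitions_on:
  assumes "finite V"
  shows "finite {\<pi>. partition_on V \<pi> \<and> P \<pi>}"
proof (rule finite_subset)
  show "{\<pi>. partition_on V \<pi> \<and> P \<pi>} \<subseteq> Pow (Pow V)" by (auto simp: partition_on_def)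
qed (use assms in simp)

text \<open>
  The condition \<open>D \<in> insert {} \<pi>\<close> says that \<open>D\<close> is a block or empty; likewise \<open>B = {}\<close> in
  \<open>add_to_block\<close> creates the block \<open>{v}\<close>. This covers the case \<open>e = V\<close> below without a case split.
\<close>

lemma sum_moebius_weight_fibre:
  assumes "finite V" "v \<in> V" "v \<notin> D" "\<not> V \<subseteq> insert v D" "v \<notin> f"
  shows "(\<Sum>\<pi> | partition_on V \<pi> \<and> D \<in> insert {} \<pi> \<and> restrict_partition \<pi> f = \<rho>.
            moebius_weight (card (\<pi> - {D}))) = 0"
    (is "sum ?w ?X = 0")
proof -
  define T where "T = {\<tau>. partition_on (V - {v}) \<tau> \<and> D \<in> insert {} \<tau> \<and> restrict_partition \<tau> f = \<rho>}"
  \<comment> \<open>Adding \<open>v\<close> to \<open>D\<close> is excluded because \<open>D\<close>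
    has to survive unchanged; the choice \<open>{}\<close> remains even when \<open>D\<close> is
    empty.\<close>
  define S where "S = (SIGMA \<tau>:T. insert {} (\<tau> - {D}))"
  let ?g = "\<lambda>(\<tau>, B). add_to_block v \<tau> B"
  have finT: "finite T" unfolding T_def by (rule finite_partitions_on) (use assms in simp)
  have fin: "finite \<tau>" if "\<tau> \<in> T" for \<tau>
    using that finite_elements[of "V - {v}" \<tau>] assms(1) unfolding T_def by blast
  have vT: "v \<notin> p" if "\<tau> \<in> T" "p \<in> \<tau>" for \<tau> p
    using that unfolding T_def partition_on_def by blast
  have inj: "inj_on ?g S"
  proof (rule inj_onI)
    fix x y assume xy: "x \<in> S" "y \<in> S" and eq: "?g x = ?g y"
    obtain \<tau> B \<tau>' B' where [simp]: "x = (\<tau>, B)" "y = (\<tau>', B')" by (cases x, cases y) auto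
    have "\<tau> = \<tau>' \<and> B = B'"
      by (rule add_to_block_inject[of "V - {v}" _ _ v])
        (use xy eq in \<open>auto simp: S_def T_def\<close>)
    then show "x = y" by simp
  qed
  have img: "?g ` S = ?X"
  proof (rule equalityI; rule subsetI)
    fix \<pi> assume "\<pi> \<in> ?g ` S"
    then obtain \<tau> B where t: "\<tau> \<in> T" "B \<in> insert {} (\<tau> - {D})" "\<pi> = add_to_block v \<tau> B"
      unfolding S_def by auto
    have B: "B \<in> insert {} \<tau>" using t by blast
    have "partition_on V \<pi>"
      using partition_on_add_to_block[OF _ assms(2) B] t by (simp add: T_def)
    moreover have "restrict_partition \<pi> f = \<rho>"
      using t B assms(5) by (simp add: T_def restrict_add_to_block)
    moreover have "D \<in> insert {} \<pi>"
      using t(1,2) unfolding t(3) T_def add_to_block_def by auto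
    ultimately show "\<pi> \<in> ?X" by simp
  next
    fix \<pi> assume X: "\<pi> \<in> ?X"
    then obtain \<tau> B where t: "partition_on (V - {v}) \<tau>" "B \<in> insert {} \<tau>" "\<pi> = add_to_block v \<tau> B"
      using partition_obtain_add_to_block[OF _ assms(2), of \<pi>] by blast
    have ne: "{} \<notin> \<tau>" using t unfolding partition_on_def by blast
    have D: "D \<in> insert {} (\<tau> - {B})"
      using X assms(3) unfolding t(3) add_to_block_def by auto
    have "restrict_partition \<tau> f = \<rho>" using X t assms(5) by (simp add: restrict_add_to_block)
    then have "\<tau> \<in> T" using t(1) D by (auto simp: T_def)
    moreover have "B \<in> insert {} (\<tau> - {D})" using t(2) D ne by blast
    ultimately show "\<pi> \<in> ?g ` S" using t(3) unfolding S_def by force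
  qed
  have "sum ?w ?X = (\<Sum>x\<in>S. ?w (?g x))"
    unfolding img[symmetric] by (simp add: sum.reindex[OF inj])
  also have "\<dots> = (\<Sum>\<tau>\<in>T. \<Sum>B\<in>insert {} (\<tau> - {D}). ?w (add_to_block v \<tau> B))"
    unfolding S_def using finT fin by (subst sum.Sigma) (auto intro!: sum.cong)
  also have "\<dots> = 0"
  proof (rule sum.neutral, rule ballI)
    fix \<tau> assume t: "\<tau> \<in> T"
    note [simp] = fin[OF t]
    have ne: "{} \<notin> \<tau>" and U: "\<Union>\<tau> = V - {v}" using t unfolding T_def partition_on_def by auto
    let ?m = "card (\<tau> - {D})"
    \<comment> \<open>Some vertex other than \<open>v\<close> lies outside \<open>D\<close>, and its
      block is counted.\<close>
    have "\<tau> - {D} \<noteq> {}" using U assms(4) by blast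
    then have m: "?m \<ge> 1" by (simp add: Suc_le_eq card_gt_0_iff)
    have "{v} \<notin> \<tau>" using vT[OF t] by blast
    moreover have "add_to_block v \<tau> {} - {D} = insert {v} (\<tau> - {D})"
      using ne assms(3) unfolding add_to_block_def by auto
    ultimately have c0: "card (add_to_block v \<tau> {} - {D}) = Suc ?m" by simp
    have c1: "card (add_to_block v \<tau> B - {D}) = ?m" if B: "B \<in> \<tau> - {D}" for B
    proof -
      have "add_to_block v \<tau> B - {D} = insert (insert v B) ((\<tau> - {D}) - {B})"
        using assms(3) unfolding add_to_block_def by auto
      moreover have "insert v B \<notin> \<tau>" using vT[OF t] by blast
      ultimately show ?thesis using B card_Suc_Diff1[of "\<tau> - {D}" B] by simp
    qed
    have "(\<Sum>B\<in>insert {} (\<tau> - {D}). ?w (add_to_block v \<tau> B))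
        = ?w (add_to_block v \<tau> {}) + (\<Sum>B\<in>\<tau> - {D}. ?w (add_to_block v \<tau> B))"
      using ne by simp
    also have "\<dots> = moebius_weight (Suc ?m) + (\<Sum>B\<in>\<tau> - {D}. moebius_weight ?m)"
      using c0 c1 by (intro arg_cong2[where f = "(+)"] sum.cong) auto
    also have "\<dots> = 0" using moebius_weight_cancel[OF m] by simp
    finally show "(\<Sum>B\<in>insert {} (\<tau> - {D}). ?w (add_to_block v \<tau> B)) = 0" .
  qed
  finally show ?thesis .
qed

section \<open>The separating vector of an edge\<close>

definition edge_weight :: "'v set \<Rightarrow> 'v set \<Rightarrow> 'v set set \<Rightarrow> real" where
  "edge_weight V e =
     (\<lambda>\<pi>\<in>R_rows V. if V - e \<in> insert {} \<pi> then moebius_weight (card (\<pi> - {V - e})) else 0)"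

lemma restrict_partition_trivial:
  assumes "partition_on V \<pi>" "card \<pi> < 2" "finite V"
  shows "card (restrict_partition \<pi> f) < 2"
proof -
  have "finite \<pi>" using assms(1,3) finite_elements by blast
  then have "card (restrict_partition \<pi> f) \<le> card \<pi>"
    unfolding restrict_partition_def
    by (metis card_Diff1_le card_image_le le_trans)
  then show ?thesis using assms(2) by simp
qed

text \<open>
  The one-block partition of \<open>V\<close>, which is not a row, contributes nothing since its restrictions are trivial.
\<close>

lemma sum_edge_weight:
  assumes "finite V" "\<rho> \<in> nontrivial_partitions f"
  shows "(\<Sum>\<pi>\<in>R_rows V. mat_transpose R_entry (f, \<rho>) \<pi> * edge_weight V e \<pi>)
    = (\<Sum>\<pi> | partition_on V \<pi> \<and> V - e \<in> insert {} \<pi> \<and> restrict_partition \<pi> f = \<rho>.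
            moebius_weight (card (\<pi> - {V - e})))"
proof (rule sum.mono_neutral_cong)
  show "finite (R_rows V)"
    unfolding R_rows_def nontrivial_partitions_def by (rule finite_partitions_on[OF assms(1)])
  show "finite {\<pi>. partition_on V \<pi> \<and> V - e \<in> insert {} \<pi> \<and> restrict_partition \<pi> f = \<rho>}"
    by (rule finite_partitions_on[OF assms(1)])
next
  fix \<pi> assume p: "\<pi> \<in> {\<pi>. partition_on V \<pi> \<and> V - e \<in> insert {} \<pi> \<and> restrict_partition \<pi> f = \<rho>} - R_rows V"
  then have "card \<rho> < 2"
    using restrict_partition_trivial[OF _ _ assms(1)]
    unfolding R_rows_def nontrivial_partitions_def by fastforce
  then show "moebius_weight (card (\<pi> - {V - e})) = 0"
    using assms(2) unfolding nontrivial_partitions_def by simp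
qed (auto simp: edge_weight_def mat_transpose_def R_entry_def R_rows_def nontrivial_partitions_def)

text \<open>Each \<open>f\<close> misses a vertex \<open>v\<close> of \<open>e\<close>, so the sum
  for a column of \<open>f\<close> is a fibre sum with \<open>D = V - e\<close>, which
  cancels.\<close>

lemma edge_weight_in_linear_equalities:
  assumes "finite V" "e \<subseteq> V" "card e \<ge> 2" and "\<And>f. f \<in> E \<Longrightarrow> \<not> e \<subseteq> f"
  shows "edge_weight V e \<in> linear_equalities V E"
proof -
  have "(\<Sum>\<pi>\<in>R_rows V. mat_transpose R_entry (f, \<rho>) \<pi> * edge_weight V e \<pi>) = 0"
    if "f \<in> E" "\<rho> \<in> nontrivial_partitions f" for f \<rho>
  proof -
    obtain v where v: "v \<in> e" "v \<notin> f" using assms(4) \<open>f \<in> E\<close> by blast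
    \<comment> \<open>A second vertex of \<open>e\<close> keeps the fibre sum away from the
      exceptional case \<open>m = 0\<close>.\<close>
    have "\<not> e \<subseteq> {v}" using assms(3) card_mono[of "{v}" e] by auto
    then have "\<not> V \<subseteq> insert v (V - e)" using assms(2) by blast
    then show ?thesis
      using v assms(1,2) that(2) by (simp only: sum_edge_weight, intro sum_moebius_weight_fibre) auto
  qed
  then show ?thesis
    unfolding linear_equalities_def mat_kernel_def R_cols_def
    by (auto simp: edge_weight_def)
qed

text \<open>Blocks other than \<open>V - e\<close> are disjoint from it, so they lie inside
  \<open>e\<close> and restriction leaves them unchanged. Thus each fibre over \<open>e\<close> has
  at most one point.\<close>

lemma partition_eq_of_restrict:
  assumes "partition_on V \<pi>" "V - e \<in> insert {} \<pi>"
  shows "\<pi> = restrict_partition \<pi> e \<union> ({V - e} - {{}})"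
proof -
  have U: "\<Union>\<pi> = V" and ne: "{} \<notin> \<pi>"
    and dj: "\<And>p q. p \<in> \<pi> \<Longrightarrow> q \<in> \<pi> \<Longrightarrow> p \<noteq> q \<Longrightarrow> p \<inter> q = {}"
    using assms(1) by (auto simp: partition_on_def disjoint_def)
  have "p \<inter> e = p" if "p \<in> \<pi> - {V - e}" for p
  proof -
    have "p \<inter> (V - e) = {}" using dj[of p "V - e"] that assms(2) by blast
    then show ?thesis using that U by blast
  qed
  then have "(\<lambda>p. p \<inter> e) ` (\<pi> - {V - e}) = \<pi> - {V - e}" by simp
  moreover have "restrict_partition \<pi> e = (\<lambda>p. p \<inter> e) ` (\<pi> - {V - e}) - {{}}"
    unfolding restrict_partition_def by auto
  ultimately have "restrict_partition \<pi> e = \<pi> - {V - e}" using ne by simp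
  then show ?thesis using assms(2) ne by auto
qed

lemma edge_weight_notin_linear_equalities:
  assumes "finite V" "e \<subseteq> V" "card e \<ge> 2" "e \<in> E"
  shows "edge_weight V e \<notin> linear_equalities V E"
proof
  assume mem: "edge_weight V e \<in> linear_equalities V E"
  obtain a where a: "a \<in> e" using assms(3) by fastforce
  have ne: "e - {a} \<noteq> {}" using assms(3) card_mono[of "{a}" e] by auto
  \<comment> \<open>A nontrivial partition of \<open>e\<close> selects a column; its fibre is the
    single partition \<open>\<pi>\<close> defined next.\<close>
  define \<rho> where "\<rho> = {{a}, e - {a}}"
  define \<pi> where "\<pi> = \<rho> \<union> ({V - e} - {{}})"
  have part: "partition_on e \<rho>"
    unfolding partition_on_def disjoint_def \<rho>_def using a ne by auto
  have "card \<rho> = 2" unfolding \<rho>_def by (subst card_2_iff) auto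
  then have nt: "\<rho> \<in> nontrivial_partitions e" using part unfolding nontrivial_partitions_def by simp
  have partV: "partition_on V \<pi>"
    unfolding partition_on_def disjoint_def \<pi>_def \<rho>_def using a ne assms(2) by auto
  have restr: "restrict_partition \<pi> e = \<rho>"
    using a ne unfolding restrict_partition_def \<pi>_def \<rho>_def by (auto simp: image_iff)
  have "{\<pi>. partition_on V \<pi> \<and> V - e \<in> insert {} \<pi> \<and> restrict_partition \<pi> e = \<rho>} = {\<pi>}"
    using partV restr partition_eq_of_restrict[of V _ e] unfolding \<pi>_def by auto
  then have "(\<Sum>\<pi>\<in>R_rows V. mat_transpose R_entry (e, \<rho>) \<pi> * edge_weight V e \<pi>)
      = moebius_weight (card (\<pi> - {V - e}))"
    by (simp add: sum_edge_weight[OF assms(1) nt])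
  moreover have "(e, \<rho>) \<in> R_cols E" using nt assms(4) unfolding R_cols_def by simp
  ultimately have "moebius_weight (card (\<pi> - {V - e})) = 0"
    using mem unfolding linear_equalities_def mat_kernel_def by auto
  \<comment> \<open>A signed factorial is never zero.\<close>
  then show False by (simp add: moebius_weight_def)
qed

section \<open>Recovering the edges from the linear equalities\<close>

lemma edge_subset_of_linear_equalities_subset:
  assumes "finite V" "e \<subseteq> V" "card e \<ge> 2" "e \<in> E1"
    and "linear_equalities V E2 \<subseteq> linear_equalities V E1"
  obtains f where "f \<in> E2" "e \<subseteq> f"
  using assms edge_weight_in_linear_equalities[OF assms(1-3)]
    edge_weight_notin_linear_equalities[OF assms(1-4)] by blast

text \<open>Passing from \<open>E1\<close> to \<open>E2\<close> and back gives a chain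
  \<open>e \<subseteq> f \<subseteq> g\<close> with \<open>e\<close> and \<open>g\<close> in
  \<open>E1\<close>; the antichain property collapses it to \<open>e = f\<close>.\<close>

lemma sperner_edges_subset:
  assumes "sperner_hypergraph V E1" "sperner_hypergraph V E2"
    and "\<And>e. e \<in> E1 \<Longrightarrow> card e \<ge> 2" and "\<And>e. e \<in> E2 \<Longrightarrow> card e \<ge> 2"
    and "linear_equalities V E1 = linear_equalities V E2"
  shows "E1 \<subseteq> E2"
proof
  have V: "finite V" "E1 \<subseteq> Pow V" "E2 \<subseteq> Pow V"
    using assms(1,2) unfolding sperner_hypergraph_def by auto
  fix e assume e: "e \<in> E1"
  then obtain f where f: "f \<in> E2" "e \<subseteq> f"
    using edge_subset_of_linear_equalities_subset[of V e E1 E2] V assms(3,5) by blast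
  then obtain g where g: "g \<in> E1" "f \<subseteq> g"
    using edge_subset_of_linear_equalities_subset[of V f E2 E1] V assms(4,5) by blast
  have "e = g"
    using assms(1) e f g unfolding sperner_hypergraph_def pairwise_def by blast
  then show "e \<in> E2" using f g by auto
qed

theorem mainTheorem2:
  fixes V :: "'v set" and n :: nat and E1 E2 :: "'v set set"
  assumes "finite V" and "card V = n"
    and "sperner_hypergraph V E1" and "sperner_hypergraph V E2"
    and "\<And>e. e \<in> E1 \<Longrightarrow> card e \<ge> 2" and "\<And>e. e \<in> E2 \<Longrightarrow> card e \<ge> 2"
    and "linear_equalities V E1 = linear_equalities V E2"
  shows "E1 = E2"
  using sperner_edges_subset[of V E1 E2] sperner_edges_subset[of V E2 E1] assms by blast

end
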